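(* Let $p\ge1$ be an odd integer. In the multimodal linear search problem with $p$ modes, no algorithm $\mathcal{A}$ satisfies $CR_{\mathcal{A}}<2p+3+\sqrt{8(p+1)}$.
   Context: **Problem.** A point-like searcher starts at the origin of the real line at time $0$ and moves with speed at most $1$. A stationary target is at an unknown coordinate at distance $d\ge 1$ from the origin. The searcher has $p$ search modes, and a target is detected only when the searcher passes through its location in the (unknown) correct mode. The searcher may switch direction and mode instantaneously, but needs at least $L$ time to search an interval of length $L$ for every mode used. A coordinate $x$ is *explored* by time $t$ if the searcher has passed through $x$ in each of the $p$ modes at or before time $t$. By convention every $x$ with $|x|<1$ counts as explored at time $0$. Without loss of generality the positive direction is the one in which the searcher first reaches distance $1$ from the origin. **Algorithms.** An algorithm is a pattern of motion of the searcher together with its use of modes. Infinitely precise motion is permitted (for instance, for odd $p$, moving at speed $1/p$ while searching in all $p$ modes simultaneously). To determine whether a pattern of motion is valid, one imagines a scenario where motion is restricted to small, discrete steps of size $\varepsilon$, in each of which the searcher uses one search mode and moves a distance $\varepsilon$ with speed $1$ in either direction. A pattern of motion is valid if it can be approximated arbitrarily well in this restricted case as $\varepsilon$ tends to $0$. Only algorithms for which every coordinate has a finite exploration time are considered. **Competitive ratio.** For an algorithm $\mathcal{A}$ (analyzed as if it never stops), let $T_{\mathcal{A}}(x)=\inf\{t\ge 0: x \text{ is explored by time } t\}$, $CR_{\mathcal{A}}(x)=T_{\mathcal{A}}(x)/|x|$, and $CR_{\mathcal{A}}=\sup_x CR_{\mathcal{A}}(x)$, the supremum being effectively over $|x|\ge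 1$. *)

theory Defs
  imports Complex_Main "HOL-Library.Extended_Real"
begin

text \<open>
  A pattern of motion: the coordinate of the searcher at each time \<open>t \<ge> 0\<close> and the set of modes
  in which it is searching at that time. The modes are numbered \<open>0, \<dots>, p - 1\<close>. Several modes in
  use at once (for instance all \<open>p\<close> modes at speed \<open>1/p\<close>) are an idealisation, to be justified
  by \<open>valid_pattern\<close> below.
\<close>

record pattern =
  pos :: "real \<Rightarrow> real"
  modes :: "real \<Rightarrow> nat set"

definition passes :: "pattern \<Rightarrow> nat \<Rightarrow> real \<Rightarrow> real \<Rightarrow> bool" where
  "passes A m x t \<longleftrightarrow> pos A t = x \<and> m \<in> modes A t"

definition explored :: "nat \<Rightarrow> pattern \<Rightarrow> real \<Rightarrow> real \<Rightarrow> bool" where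
  "explored p A x t \<longleftrightarrow> \<bar>x\<bar> < 1 \<or> (\<forall>m<p. \<exists>s. 0 \<le> s \<and> s \<le> t \<and> passes A m x s)"

text \<open>
  Motion in discrete steps of size \<open>\<epsilon>\<close>: during the time interval \<open>[k\<epsilon>, (k + 1)\<epsilon>]\<close> the searcher moves
  with speed 1 in direction \<open>d k\<close> (which is 1 or -1) and uses the single mode \<open>m k\<close>. The time
  intervals of the steps are closed, so both end points of a step are passed in its mode.
\<close>

definition walk :: "real \<Rightarrow> (nat \<Rightarrow> real) \<Rightarrow> (nat \<Rightarrow> nat) \<Rightarrow> pattern" where
  "walk \<epsilon> d m =
     \<lparr> pos = (\<lambda>t. let k = nat \<lfloor>t / \<epsilon>\<rfloor> in \<epsilon> * (\<Sum>i<k. d i) + d k * (t - real k * \<epsilon>)),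
       modes = (\<lambda>t. {m k | k. real k * \<epsilon> \<le> t \<and> t \<le> real (Suc k) * \<epsilon>}) \<rparr>"

text \<open>
  \<open>B\<close> approximates \<open>A\<close> up to time \<open>H\<close> with error \<open>\<delta>\<close>: it stays \<open>\<delta>\<close>-close to \<open>A\<close>, and it passes through
  every coordinate in every mode in which \<open>A\<close> does so, with a difference in time of at most \<open>\<delta>\<close>.
  The coordinate is matched exactly, since matching it only up to \<open>\<delta>\<close> would allow \<open>B\<close> to leave
  gaps in what \<open>A\<close> searches. \<open>B\<close> may search more than \<open>A\<close>, so that \<open>A\<close> may move without searching.
\<close>

definition approximates :: "real \<Rightarrow> real \<Rightarrow> pattern \<Rightarrow> pattern \<Rightarrow> bool" where
  "approximates \<delta> H B A \<longleftrightarrow>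
     (\<forall>t\<in>{0..H}. \<bar>pos B t - pos A t\<bar> \<le> \<delta>) \<and>
     (\<forall>t\<in>{0..H}. \<forall>m\<in>modes A t. \<exists>s\<ge>0. \<bar>s - t\<bar> \<le> \<delta> \<and> passes B m (pos A t) s)"

text \<open>
  The approximation is required on bounded time intervals only: for a fixed \<open>\<epsilon>\<close>, the delays of order
  \<open>\<epsilon>\<close> at turning points that are not multiples of \<open>\<epsilon>\<close> may add up without bound.
\<close>

definition valid_pattern :: "nat \<Rightarrow> pattern \<Rightarrow> bool" where
  "valid_pattern p A \<longleftrightarrow>
     (\<forall>\<delta>>0. \<forall>H>0. \<forall>\<^sub>F \<epsilon> in at_right 0.
        \<exists>d m. (\<forall>k. d k \<in> {-1, 1}) \<and> (\<forall>k. m k < p) \<and> approximates \<delta> H (walk \<epsilon> d m) A)"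

definition search_algorithm :: "nat \<Rightarrow> pattern \<Rightarrow> bool" where
  "search_algorithm p A \<longleftrightarrow>
     pos A 0 = 0 \<and>
     (\<forall>s\<ge>0. \<forall>t\<ge>0. \<bar>pos A s - pos A t\<bar> \<le> \<bar>s - t\<bar>) \<and>
     (\<forall>t\<ge>0. modes A t \<subseteq> {..<p}) \<and>
     valid_pattern p A \<and>
     (\<forall>x. \<exists>t\<ge>0. explored p A x t)"

definition exploration_time :: "nat \<Rightarrow> pattern \<Rightarrow> real \<Rightarrow> real" where
  "exploration_time p A x = Inf {t. 0 \<le> t \<and> explored p A x t}"

definition CR_at :: "nat \<Rightarrow> pattern \<Rightarrow> real \<Rightarrow> real" where
  "CR_at p A x = exploration_time p A x / \<bar>x\<bar>"

text \<open>Coordinates with \<open>\<bar>x\<bar> < 1\<close> have exploration time 0 and do not contribute to the supremum.\<close>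

definition CR :: "nat \<Rightarrow> pattern \<Rightarrow> ereal" where
  "CR p A = (SUP x\<in>{x. 1 \<le> \<bar>x\<bar>}. ereal (CR_at p A x))"

end

theory Submission
  imports Defs
begin

text \<open>
  Validity turns an algorithm into a walk with unit steps on the integers that crosses every edge
  at distance \<open>x\<close>, in a bounded but arbitrarily long range, at least \<open>p\<close> times by time \<open>c x\<close>.
  Let \<open>y\<^sub>0, y\<^sub>1, \<dots>\<close> be the distances up to which the two sides are explored, alternately, each
  taken at the moment when the exploration of the other side progresses. An explored edge on the
  side where the searcher is not has been crossed an even number of times, so at least \<open>p + 1\<close>
  times since \<open>p\<close> is odd, and at least once more in each later phase. When the exploration
  progresses beyond \<open>y\<^bsub>n-1\<^esub>\<close>, the total number of crossings is thus at least
  \<open>(p + 1) y\<^sub>n + (p + 2) y\<^bsub>n-1\<^esub> + 2 (y\<^bsub>n-2\<^esub> + y\<^bsub>n-3\<^esub> + \<dots>)\<close>, which is at most \<open>c y\<^bsub>n-1\<^esub>\<close>.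
  Up to lower-order terms, this says for the partial sums \<open>S\<^sub>n\<close> that
  \<open>(p + 1) S\<^sub>n - (c - 1) S\<^bsub>n-1\<^esub> + (c - p) S\<^bsub>n-2\<^esub> \<le> 0\<close>. For
  \<open>c < 2p + 3 + \<surd>(8(p + 1))\<close> the discriminant is negative, the ratios \<open>y\<^sub>n / S\<^bsub>n-1\<^esub>\<close>
  decrease by at least a fixed amount in each phase, and they cannot stay positive.
\<close>

section \<open>Walks on the integers and the parity of edge crossings\<close>

locale unit_walk =
  fixes w :: "nat \<Rightarrow> int"
  assumes start: "w 0 = 0"
    and step: "\<bar>w (Suc k) - w k\<bar> = 1"
begin

text \<open>The factor \<sigma> mirrors the line, so that one definition serves both half-lines; an
  edge is indexed by the distance of its end nearer to the origin.\<close>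

definition crossings :: "int \<Rightarrow> nat \<Rightarrow> nat \<Rightarrow> nat" where
  "crossings \<sigma> j t = card {k. k < t \<and> min (\<sigma> * w k) (\<sigma> * w (Suc k)) = int j}"

lemma crossings_0 [simp]: "crossings \<sigma> j 0 = 0"
  by (simp add: crossings_def)

lemma crossings_Suc:
  "crossings \<sigma> j (Suc t) = crossings \<sigma> j t +
     (if min (\<sigma> * w t) (\<sigma> * w (Suc t)) = int j then 1 else 0)"
proof -
  let ?P = "\<lambda>k. min (\<sigma> * w k) (\<sigma> * w (Suc k)) = int j"
  have "{k. k < Suc t \<and> ?P k} = (if ?P t then insert t {k. k < t \<and> ?P k} else {k. k < t \<and> ?P k})"
    by (auto simp: less_Suc_eq)
  then show ?thesis
    by (simp add: crossings_def)
qed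

lemma crossings_mono: "s \<le> t \<Longrightarrow> crossings \<sigma> j s \<le> crossings \<sigma> j t"
  unfolding crossings_def by (rule card_mono) auto

text \<open>The walk starts on the near side of every edge, and each crossing changes the
  side.\<close>

lemma even_crossings_iff:
  assumes "\<sigma> \<in> {1, -1}"
  shows "even (crossings \<sigma> j t) \<longleftrightarrow> \<sigma> * w t \<le> int j"
proof (induction t)
  case 0
  then show ?case by (simp add: start)
next
  case (Suc t)
  have "\<bar>\<sigma> * w (Suc t) - \<sigma> * w t\<bar> = 1"
    using assms step[of t] by auto
  then show ?case
    using Suc unfolding crossings_Suc by (auto simp: min_def)
qed

lemma crossings_less:
  assumes "\<sigma> \<in> {1, -1}" "s \<le> t" "\<sigma> * w s \<le> int j \<longleftrightarrow> \<not> \<sigma> * w t \<le> int j"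
  shows "crossings \<sigma> j s < crossings \<sigma> j t"
  using crossings_mono[OF assms(2)] even_crossings_iff[OF assms(1)] assms(3)
  by (metis le_neq_implies_less)

text \<open>Each step crosses just one edge, which lies on only one side of the origin; time thus
  bounds the total number of crossings.\<close>

lemma sum_crossings_le:
  assumes \<sigma>: "\<sigma> \<in> {1, -1}" and "finite A" "finite B"
  shows "(\<Sum>j\<in>A. crossings \<sigma> j t) + (\<Sum>j\<in>B. crossings (-\<sigma>) j t) \<le> t"
proof (induction t)
  case (Suc t)
  define x where "x = min (\<sigma> * w t) (\<sigma> * w (Suc t))"
  define y where "y = min (-\<sigma> * w t) (-\<sigma> * w (Suc t))"
  have "\<bar>\<sigma> * w (Suc t) - \<sigma> * w t\<bar> = 1"
    using \<sigma> step[of t] by auto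
  \<comment> \<open>If both minima were nonnegative, both ends of the step would be 0.\<close>
  then have xy: "x < 0 \<or> y < 0"
    unfolding x_def y_def by auto
  have le: "(\<Sum>j\<in>F. if z = int j then 1 else 0 :: nat) \<le> (if z < 0 then 0 else 1)"
    if "finite F" for F z
  proof -
    have "(\<Sum>j\<in>F. if z = int j then 1 else 0 :: nat) = card {j\<in>F. z = int j}"
      using that by (simp add: sum.If_cases Int_def)
    also have "\<dots> \<le> card (if z < 0 then {} else {nat z})"
      by (rule card_mono) auto
    finally show ?thesis by (simp split: if_splits)
  qed
  show ?case
    using Suc le[OF \<open>finite A\<close>, of x] le[OF \<open>finite B\<close>, of y] xy
    unfolding crossings_Suc sum.distrib x_def[symmetric] y_def[symmetric]
    by (auto split: if_splits)
qed simp

lemma finite_crossed: "finite {j. 0 < crossings \<sigma> j t}"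
proof (induction t)
  case (Suc t)
  have "{j. 0 < crossings \<sigma> j (Suc t)} \<subseteq>
      {j. 0 < crossings \<sigma> j t} \<union> {nat (min (\<sigma> * w t) (\<sigma> * w (Suc t)))}"
    by (auto simp: crossings_Suc split: if_splits)
  with Suc show ?case
    by (meson finite.emptyI finite.insertI finite_UnI finite_subset)
qed simp

section \<open>Frontiers of exploration and moments of progress\<close>

definition frontier :: "nat \<Rightarrow> nat \<Rightarrow> int \<Rightarrow> nat \<Rightarrow> nat \<Rightarrow> bool" where
  "frontier p J \<sigma> t a \<longleftrightarrow>
     J \<le> a \<and> crossings \<sigma> a t < p \<and> (\<forall>j\<in>{J..<a}. p \<le> crossings \<sigma> j t)"

lemma frontier_exists:
  assumes "0 < p"
  obtains a where "frontier p J \<sigma> t a"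
proof -
  have "infinite ({J..} - {j. 0 < crossings \<sigma> j t})"
    by (simp add: finite_crossed infinite_Ici)
  then obtain j where "J \<le> j" "crossings \<sigma> j t = 0"
    by (metis (mono_tags, lifting) DiffE atLeast_iff finite.emptyI ex_in_conv gr0I mem_Collect_eq)
  then have ex: "\<exists>j. J \<le> j \<and> crossings \<sigma> j t < p"
    using assms by auto
  define a where "a = (LEAST j. J \<le> j \<and> crossings \<sigma> j t < p)"
  have "J \<le> a \<and> crossings \<sigma> a t < p"
    unfolding a_def by (rule LeastI_ex[OF ex])
  moreover have "p \<le> crossings \<sigma> j t" if "j \<in> {J..<a}" for j
    using not_less_Least[of j "\<lambda>j. J \<le> j \<and> crossings \<sigma> j t < p"] that
    unfolding a_def[symmetric] by auto
  ultimately have "frontier p J \<sigma> t a"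
    unfolding frontier_def by blast
  then show ?thesis by (rule that)
qed

lemma frontier_le:
  assumes "frontier p J \<sigma> t a" "\<sigma> \<in> {1, -1}"
  shows "p * (a - J) \<le> t"
proof -
  have "p * (a - J) = (\<Sum>j\<in>{J..<a}. p)" by simp
  also have "\<dots> \<le> (\<Sum>j\<in>{J..<a}. crossings \<sigma> j t)"
    using assms(1) by (intro sum_mono) (auto simp: frontier_def)
  also have "\<dots> \<le> t"
    using sum_crossings_le[OF assms(2), of "{J..<a}" "{}" t] by simp
  finally show ?thesis .
qed

text \<open>When the count first reaches \<open>p\<close> it equals \<open>p\<close>, which is odd,
  so the walk has just come out beyond the edge.\<close>

lemma exploration_step:
  assumes "odd p" "\<sigma> \<in> {1, -1}" "crossings \<sigma> j T < p" "p \<le> crossings \<sigma> j u"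
  obtains t where "T < t" "t \<le> u" "p \<le> crossings \<sigma> j t" "int j < \<sigma> * w t"
proof -
  define t where "t = (LEAST t. p \<le> crossings \<sigma> j t)"
  have t: "p \<le> crossings \<sigma> j t"
    unfolding t_def by (rule LeastI[of _ u]) (rule assms)
  have "t \<le> u"
    unfolding t_def by (rule Least_le) (rule assms)
  have "T < t"
    using t assms(3) crossings_mono[of t T \<sigma> j] by (meson leD le_less_trans not_less)
  then obtain t' where t': "t = Suc t'"
    by (cases t) auto
  then have "\<not> p \<le> crossings \<sigma> j t'"
    using not_less_Least[of t' "\<lambda>t. p \<le> crossings \<sigma> j t"] unfolding t_def[symmetric] by simp
  then have "crossings \<sigma> j t = p"
    using t unfolding t' crossings_Suc by (auto split: if_splits)
  then have "int j < \<sigma> * w t"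
    using even_crossings_iff[OF assms(2), of j t] assms(1) by simp
  then show ?thesis
    using that t \<open>t \<le> u\<close> \<open>T < t\<close> by blast
qed

text \<open>A snapshot at a moment of progress: the walk is beyond the explored edge
  \<open>b\<close>, and \<open>a\<close> is the frontier on the other side. \<open>V\<close> leaves
  out \<open>b\<close>, which the next phase counts among the edges that receive p + 1 crossings.
  \<open>J\<close> stands for distance about 1, as nearer coordinates need no search.\<close>

definition switch :: "nat \<Rightarrow> nat \<Rightarrow> int \<Rightarrow> nat \<Rightarrow> nat \<Rightarrow> nat \<Rightarrow> nat \<Rightarrow> bool" where
  "switch p J \<sigma> t a b V \<longleftrightarrow>
     \<sigma> \<in> {1, -1} \<and> J \<le> b \<and> int b < \<sigma> * w t \<and> (\<forall>j\<in>{J..b}. p \<le> crossings \<sigma> j t) \<and>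
     frontier p J (-\<sigma>) t a \<and>
     V = (\<Sum>j\<in>{J..<b}. crossings \<sigma> j t) + (\<Sum>j\<in>{J..<a}. crossings (-\<sigma>) j t)"

lemma switch_le: "switch p J \<sigma> t a b V \<Longrightarrow> V \<le> t"
  using sum_crossings_le[of \<sigma> "{J..<b}" "{J..<a}" t] by (auto simp: switch_def)

text \<open>
  The searcher must come back from side \<open>\<sigma>\<close>: edges explored there have then been crossed an even
  number of times, so at least \<open>p + 1\<close> times as \<open>p\<close> is odd.
\<close>

lemma switch_next:
  assumes "odd p" and sw: "switch p J \<sigma> t a b V" and u: "p \<le> crossings (-\<sigma>) a u"
  obtains t' a' V' where "t' \<le> u" "switch p J (-\<sigma>) t' a' a V'" "b < a'"
    "V + (a - J) + (b - J) + (p + 1) * (a' - b) \<le> V'"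
proof -
  from sw have \<sigma>: "\<sigma> \<in> {1, -1}" and "J \<le> b" and wt: "int b < \<sigma> * w t"
    and expl: "\<And>j. j \<in> {J..b} \<Longrightarrow> p \<le> crossings \<sigma> j t" and fr: "frontier p J (-\<sigma>) t a"
    and V: "V = (\<Sum>j\<in>{J..<b}. crossings \<sigma> j t) + (\<Sum>j\<in>{J..<a}. crossings (-\<sigma>) j t)"
    by (auto simp: switch_def)
  from \<sigma> have \<sigma>': "-\<sigma> \<in> {1, -1}" by auto
  from fr have "J \<le> a" "crossings (-\<sigma>) a t < p" and
    expl': "\<And>j. j \<in> {J..<a} \<Longrightarrow> p \<le> crossings (-\<sigma>) j t"
    by (auto simp: frontier_def)
  then obtain t' where t': "t < t'" "t' \<le> u" "p \<le> crossings (-\<sigma>) a t'" "int a < -\<sigma> * w t'"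
    using exploration_step[OF \<open>odd p\<close> \<sigma>' _ u] by blast
  obtain a' where a': "frontier p J \<sigma> t' a'"
    using frontier_exists \<open>odd p\<close> by (metis odd_pos)
  then have "J \<le> a'" "crossings \<sigma> a' t' < p" by (auto simp: frontier_def)
  have "b < a'"
  proof (rule ccontr)
    assume "\<not> b < a'"
    with \<open>J \<le> a'\<close> have "p \<le> crossings \<sigma> a' t" by (intro expl) auto
    with crossings_mono[of t t' \<sigma> a'] t' \<open>crossings \<sigma> a' t' < p\<close> show False by simp
  qed
  define V' where "V' = (\<Sum>j\<in>{J..<a}. crossings (-\<sigma>) j t') + (\<Sum>j\<in>{J..<a'}. crossings \<sigma> j t')"
  have "p \<le> crossings (-\<sigma>) j t'" if "j \<in> {J..a}" for j
    using that t' expl'[of j] crossings_mono[of t t' "-\<sigma>" j] by (cases "j = a") auto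
  then have "switch p J (-\<sigma>) t' a' a V'"
    unfolding switch_def using \<sigma>' \<open>J \<le> a\<close> t' a' V'_def by auto
  moreover have "V + (a - J) + (b - J) + (p + 1) * (a' - b) \<le> V'"
  proof -
    \<comment> \<open>From \<open>t\<close> to \<open>t'\<close> the walk goes from beyond
      \<open>b\<close> on side \<sigma> to beyond \<open>a\<close> on the other side, so the edges
      below \<open>b\<close> and below \<open>a\<close> on their sides change parity and gain a
      crossing.\<close>
    have "(\<Sum>j\<in>{J..<a}. crossings (-\<sigma>) j t) + (a - J) = (\<Sum>j\<in>{J..<a}. crossings (-\<sigma>) j t + 1)"
      by (simp only: sum.distrib) simp
    also have "\<dots> \<le> (\<Sum>j\<in>{J..<a}. crossings (-\<sigma>) j t')"
      using crossings_less[OF \<sigma>', of t t'] t' wt by (intro sum_mono) (simp add: Suc_le_eq)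
    finally have 1: "(\<Sum>j\<in>{J..<a}. crossings (-\<sigma>) j t) + (a - J) \<le> \<dots>" .
    have "(\<Sum>j\<in>{J..<b}. crossings \<sigma> j t) + (b - J) = (\<Sum>j\<in>{J..<b}. crossings \<sigma> j t + 1)"
      by (simp only: sum.distrib) simp
    also have "\<dots> \<le> (\<Sum>j\<in>{J..<b}. crossings \<sigma> j t')"
      using crossings_less[OF \<sigma>, of t t'] t' wt by (intro sum_mono) (simp add: Suc_le_eq)
    finally have 2: "(\<Sum>j\<in>{J..<b}. crossings \<sigma> j t) + (b - J) \<le> \<dots>" .
    have "(p + 1) * (a' - b) = (\<Sum>j\<in>{b..<a'}. p + 1)" by simp
    also have "\<dots> \<le> (\<Sum>j\<in>{b..<a'}. crossings \<sigma> j t')"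
    proof (rule sum_mono)
      fix j assume "j \<in> {b..<a'}"
      then have "p \<le> crossings \<sigma> j t'" using a' \<open>J \<le> b\<close> by (auto simp: frontier_def)
      moreover have "even (crossings \<sigma> j t')"
        using even_crossings_iff[OF \<sigma>] t' by simp
      ultimately show "p + 1 \<le> crossings \<sigma> j t'"
        using \<open>odd p\<close> by (cases "crossings \<sigma> j t' = p") auto
    qed
    finally have 3: "(p + 1) * (a' - b) \<le> \<dots>" .
    have "(\<Sum>j\<in>{J..<a'}. crossings \<sigma> j t') =
        (\<Sum>j\<in>{J..<b}. crossings \<sigma> j t') + (\<Sum>j\<in>{b..<a'}. crossings \<sigma> j t')"
      using \<open>J \<le> b\<close> \<open>b < a'\<close> by (simp add: sum.atLeastLessThan_concat)
    with 1 2 3 show ?thesis unfolding V V'_def by linarith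
  qed
  ultimately show ?thesis
    using that t' \<open>b < a'\<close> by blast
qed

text \<open>Starting after \<open>T\<close> puts both frontiers beyond \<open>M\<close>. The
  snapshot is taken when the positive frontier at time \<open>T\<close> becomes explored; the walk
  is then on the positive side, so counts on the negative side are even.\<close>

lemma switch_exists:
  assumes "odd p"
    and T: "\<And>\<sigma> j. \<sigma> \<in> {1, -1} \<Longrightarrow> j \<in> {J..M} \<Longrightarrow> p \<le> crossings \<sigma> j T"
    and "J \<le> M"
    and u: "\<And>b. frontier p J 1 T b \<Longrightarrow> \<exists>u. real u \<le> c * real b \<and> p \<le> crossings 1 b u"
  obtains t a b V where "switch p J 1 t a b V" "real t \<le> c * real b" "M < a" "M < b"
    "frontier p J 1 T b"
    "(p + 1) * (a - J) + p * (b - J) \<le> V"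
proof -
  have "0 < p" using \<open>odd p\<close> by (rule odd_pos)
  have gt: "M < a" if "T \<le> t" "frontier p J \<sigma> t a" "\<sigma> \<in> {1, -1}" for t a \<sigma>
  proof (rule ccontr)
    assume "\<not> M < a"
    with that have "p \<le> crossings \<sigma> a T" by (intro T) (auto simp: frontier_def)
    with crossings_mono[of T t \<sigma> a] that show False by (simp add: frontier_def)
  qed
  obtain b where b: "frontier p J 1 T b" using frontier_exists[OF \<open>0 < p\<close>] .
  obtain u where ub: "real u \<le> c * real b" "p \<le> crossings 1 b u"
    using u[OF b] by blast
  have "crossings 1 b T < p" using b by (simp add: frontier_def)
  then obtain t where "t \<le> u" and t: "T < t" "p \<le> crossings 1 b t" "int b < 1 * w t"
    using exploration_step[OF \<open>odd p\<close> _ _ ub(2)] by blast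
  then have "real t \<le> c * real b" using ub(1) by linarith
  obtain a where a: "frontier p J (-1) t a" using frontier_exists[OF \<open>0 < p\<close>] .
  define V where "V = (\<Sum>j\<in>{J..<b}. crossings 1 j t) + (\<Sum>j\<in>{J..<a}. crossings (-1) j t)"
  have expl: "p \<le> crossings 1 j t" if "j \<in> {J..b}" for j
    using that t b crossings_mono[of T t 1 j] by (cases "j = b")
      (auto simp: frontier_def intro: order_trans)
  then have "switch p J 1 t a b V"
    using a b t unfolding switch_def V_def by (auto simp: frontier_def)
  moreover have "(p + 1) * (a - J) + p * (b - J) \<le> V"
  proof -
    have "p * (b - J) = (\<Sum>j\<in>{J..<b}. p)" by simp
    also have "\<dots> \<le> (\<Sum>j\<in>{J..<b}. crossings 1 j t)"
      by (intro sum_mono expl) auto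
    finally have 1: "p * (b - J) \<le> \<dots>" .
    have "(p + 1) * (a - J) = (\<Sum>j\<in>{J..<a}. p + 1)" by simp
    also have "\<dots> \<le> (\<Sum>j\<in>{J..<a}. crossings (-1) j t)"
    proof (rule sum_mono)
      fix j assume "j \<in> {J..<a}"
      then have "p \<le> crossings (-1) j t" using a by (auto simp: frontier_def)
      moreover have "even (crossings (-1) j t)"
        using even_crossings_iff[of "-1"] t by simp
      ultimately show "p + 1 \<le> crossings (-1) j t"
        using \<open>odd p\<close> by (cases "crossings (-1) j t = p") auto
    qed
    finally have 2: "(p + 1) * (a - J) \<le> \<dots>" .
    from 1 2 show ?thesis unfolding V_def by linarith
  qed
  ultimately show ?thesis
    using that t b a \<open>real t \<le> c * real b\<close> gt[of t "-1" a] gt[of T 1 b] by simp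
qed


text \<open>\<open>s\<close> is meant as the partial sum of the distances before \<open>a\<close>.
  The bound on \<open>V\<close> reproduces itself: one more crossing raises the coefficient of
  \<open>b - J\<close> to p + 1, which merges with the new edges from \<open>b\<close> to
  \<open>a'\<close>, and that of \<open>a - J\<close> to p + 2, of which 2 go into the new partial
  sum.\<close>

lemma switch_next_real:
  assumes "odd p" and sw: "switch p J \<sigma> t a b V" and "0 \<le> c"
    and u: "\<exists>u. real u \<le> c * real a \<and> p \<le> crossings (-\<sigma>) a u"
    and V: "(real p + 1) * (real a - J) + p * (real b - J) + 2 * s \<le> V"
  obtains t' a' V' where "switch p J (-\<sigma>) t' a' a V'" "b < a'" "real V' \<le> c * real a"
    "(real p + 1) * (real a' - J) + p * (real a - J) + 2 * (s + (real a - J)) \<le> V'"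
proof -
  obtain u where "real u \<le> c * real a" "p \<le> crossings (-\<sigma>) a u" using u by blast
  then obtain t' a' V' where *: "t' \<le> u" "switch p J (-\<sigma>) t' a' a V'" "b < a'"
    "V + (a - J) + (b - J) + (p + 1) * (a' - b) \<le> V'"
    using switch_next[OF \<open>odd p\<close> sw] by metis
  have "J \<le> a" "J \<le> b" using sw by (auto simp: switch_def frontier_def)
  have "real V + (real a - J) + (real b - J) + (real p + 1) * (real a' - b) \<le> V'"
    using of_nat_mono[OF *(4), where 'a = real] \<open>J \<le> a\<close> \<open>J \<le> b\<close> \<open>b < a'\<close>
    by (simp only: of_nat_add of_nat_mult of_nat_1 of_nat_diff less_imp_le)
  with V have "(real p + 1) * (real a' - J) + p * (real a - J) + 2 * (s + (real a - J)) \<le> V'"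
    by (simp add: algebra_simps)
  moreover have "real V' \<le> c * real a"
    using switch_le[OF *(2)] *(1) \<open>real u \<le> c * real a\<close> by linarith
  ultimately show ?thesis using that * by blast
qed

end

section \<open>Decrease of the ratios under a negative discriminant\<close>

lemma ratio_decrease:
  fixes P e c \<kappa> \<rho> \<alpha> \<alpha>' s :: real
  assumes "0 < P" "0 < s" "\<alpha> \<le> \<rho> * s" "0 \<le> \<alpha>"
    and disc: "(e + P * \<kappa>)\<^sup>2 \<le> 4 * P * (2 - P * \<kappa>)"
    and step: "P * \<alpha>' \<le> (e + P) * \<alpha> - 2 * s"
  shows "\<alpha>' \<le> (\<rho> - \<kappa>) * (s + \<alpha>)"
proof -
  \<comment> \<open>With r = \<alpha> / s the key inequality is P r^2 - (e + P \<kappa>) r + 2 - P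
    \<kappa> \<ge> 0, whose discriminant is nonpositive by \<open>disc\<close>. The expression is 4
    P s^2 times this polynomial after completing the square.\<close>
  have "0 \<le> (2 * P * \<alpha> - (e + P * \<kappa>) * s)\<^sup>2 + (4 * P * (2 - P * \<kappa>) - (e + P * \<kappa>)\<^sup>2) * s\<^sup>2"
    using disc by simp
  also have "\<dots> = 4 * P * (P * (\<alpha> - \<kappa> * s) * (s + \<alpha>) - ((e + P) * \<alpha> - 2 * s) * s)"
    by (simp add: power2_eq_square algebra_simps)
  finally have "((e + P) * \<alpha> - 2 * s) * s \<le> P * (\<alpha> - \<kappa> * s) * (s + \<alpha>)"
    using \<open>0 < P\<close> by (simp add: zero_le_mult_iff)
  moreover have "P * \<alpha>' * s \<le> ((e + P) * \<alpha> - 2 * s) * s"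
    using step \<open>0 < s\<close> by (intro mult_right_mono) auto
  moreover have "P * (\<alpha> - \<kappa> * s) * (s + \<alpha>) \<le> P * ((\<rho> - \<kappa>) * s) * (s + \<alpha>)"
    using assms by (intro mult_right_mono mult_left_mono) (auto simp: algebra_simps)
  ultimately have "(P * s) * \<alpha>' \<le> (P * s) * ((\<rho> - \<kappa>) * (s + \<alpha>))"
    by (simp add: mult_ac)
  then show ?thesis
    using \<open>0 < P\<close> \<open>0 < s\<close> by (simp add: mult_le_cancel_left)
qed

text \<open>At \<kappa> = 0 the inequality is strict, so by continuity a small positive \<kappa>
  also satisfies it.\<close>

lemma negative_discriminant_margin:
  fixes P e :: real
  assumes "0 < P" "0 \<le> e" "e\<^sup>2 < 8 * P"
  obtains \<kappa> where "0 < \<kappa>" "(e + P * \<kappa>)\<^sup>2 \<le> 4 * P * (2 - P * \<kappa>)"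
proof -
  \<comment> \<open>\<mu> stands for P \<kappa>; as \<mu> \<le> 1 gives \<mu>^2 \<le> \<mu>, a
    condition linear in \<mu> suffices.\<close>
  define \<mu> where "\<mu> = min 1 ((8 * P - e\<^sup>2) / (2 * e + 1 + 4 * P))"
  have "0 < \<mu>" "\<mu> \<le> 1" using assms by (auto simp: \<mu>_def)
  have "\<mu> \<le> (8 * P - e\<^sup>2) / (2 * e + 1 + 4 * P)" by (simp add: \<mu>_def)
  then have "\<mu> * (2 * e + 1 + 4 * P) \<le> 8 * P - e\<^sup>2"
    using assms by (simp add: pos_le_divide_eq)
  moreover have "\<mu> * \<mu> \<le> \<mu> * 1"
    using \<open>0 < \<mu>\<close> \<open>\<mu> \<le> 1\<close> by (intro mult_left_mono) auto
  ultimately have "(e + \<mu>)\<^sup>2 \<le> 4 * P * (2 - \<mu>)"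
    by (simp add: power2_eq_square algebra_simps)
  then show ?thesis
    using that[of "\<mu> / P"] \<open>0 < \<mu>\<close> \<open>0 < P\<close> by simp
qed

section \<open>Iterated phases and the bound for unit walks\<close>

context unit_walk
begin

text \<open>Each phase lowers the bound on the ratio of \<open>real a - J\<close> to
  \<open>s\<close> by \<kappa>. The growth bound keeps all \<open>N\<close> phases within the range
  of \<open>expl\<close>, and beyond \<open>M\<close> the offset \<open>J\<close> is absorbed into
  the constant e + 2p + 3.\<close>

lemma switch_chain:
  fixes c e \<kappa> \<rho> D :: real and J M :: nat
  assumes "odd p" "0 \<le> c"
    and expl: "\<And>\<sigma> j. \<sigma> \<in> {1, -1} \<Longrightarrow> J \<le> j \<Longrightarrow> real j \<le> D * (1 + c) ^ N \<Longrightarrow>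
      \<exists>u. real u \<le> c * real j \<and> p \<le> crossings \<sigma> j u"
    and disc: "(e + (real p + 1) * \<kappa>)\<^sup>2 \<le> 4 * (real p + 1) * (2 - (real p + 1) * \<kappa>)"
    and M: "\<And>a. M < a \<Longrightarrow> c * real a \<le> (e + 2 * real p + 3) * (real a - J)"
    and "J \<le> M"
    and base: "switch p J \<sigma> t a b V" "M < a" "M < b" "0 < s"
      "(real p + 1) * (real a - J) + p * (real b - J) + 2 * s \<le> V"
      "real a - J \<le> \<rho> * s" "real a \<le> D"
    and "n \<le> N"
  shows "\<exists>\<sigma> t a b V s. switch p J \<sigma> t a b V \<and> M < a \<and> M < b \<and> 0 < s \<and>
    (real p + 1) * (real a - J) + p * (real b - J) + 2 * s \<le> V \<and>
    real a - J \<le> (\<rho> - real n * \<kappa>) * s \<and> real a \<le> D * (1 + c) ^ n"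
  using \<open>n \<le> N\<close>
proof (induction n)
  case 0
  show ?case
    by (intro exI[of _ \<sigma>] exI[of _ t] exI[of _ a] exI[of _ b] exI[of _ V] exI[of _ s])
      (use base in simp)
next
  case (Suc n)
  then obtain \<sigma> t a b V s where sw: "switch p J \<sigma> t a b V" and "M < a" "M < b" "0 < s"
    and V: "(real p + 1) * (real a - J) + p * (real b - J) + 2 * s \<le> V"
    and ratio: "real a - J \<le> (\<rho> - real n * \<kappa>) * s" and aD: "real a \<le> D * (1 + c) ^ n"
    by auto
  from sw have "-\<sigma> \<in> {1, -1}" "J \<le> a" by (auto simp: switch_def frontier_def)
  have "0 < D"
    using base(2,7) by linarith
  then have "D * (1 + c) ^ n \<le> D * (1 + c) ^ N"
    using Suc.prems \<open>0 \<le> c\<close> by (intro mult_left_mono power_increasing) auto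
  with aD have "real a \<le> D * (1 + c) ^ N" by linarith
  then obtain t' a' V' where sw': "switch p J (-\<sigma>) t' a' a V'" and "b < a'"
    and V'c: "real V' \<le> c * real a"
    and V': "(real p + 1) * (real a' - J) + p * (real a - J) + 2 * (s + (real a - J)) \<le> V'"
    using switch_next_real[OF \<open>odd p\<close> sw \<open>0 \<le> c\<close> expl[OF \<open>-\<sigma> \<in> {1, -1}\<close> \<open>J \<le> a\<close>] V] by blast
  have "J < a'" "J < a" using \<open>M < b\<close> \<open>b < a'\<close> \<open>M < a\<close> \<open>J \<le> M\<close> by auto
  \<comment> \<open>The lower and upper bounds on \<open>V'\<close> combine to the recurrence that
    \<open>ratio_decrease\<close> expects, with P = p + 1.\<close>
  have "(real p + 1) * (real a' - J) \<le> (e + (real p + 1)) * (real a - J) - 2 * s"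
    using V' V'c M[OF \<open>M < a\<close>] by (simp add: algebra_simps)
  then have "real a' - J \<le> (\<rho> - real n * \<kappa> - \<kappa>) * (s + (real a - J))"
    using \<open>J < a\<close> by (intro ratio_decrease[OF _ \<open>0 < s\<close> ratio _ disc]) auto
  \<comment> \<open>One crossing per edge already gives a' - J \<le> c a, and J \<le> a.\<close>
  moreover have "real a' \<le> D * (1 + c) ^ Suc n"
  proof -
    have "1 * (real a' - J) \<le> (real p + 1) * (real a' - J)"
      using \<open>J < a'\<close> by (intro mult_right_mono) auto
    moreover have "0 \<le> p * (real a - J)" using \<open>J < a\<close> by simp
    ultimately have "real a' \<le> (1 + c) * real a"
      using V' V'c \<open>0 < s\<close> \<open>J < a\<close> by (simp add: algebra_simps)
    also have "\<dots> \<le> (1 + c) * (D * (1 + c) ^ n)"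
      using aD \<open>0 \<le> c\<close> by (intro mult_left_mono) auto
    finally show ?thesis by (simp add: mult_ac)
  qed
  moreover have "\<rho> - real n * \<kappa> - \<kappa> = \<rho> - real (Suc n) * \<kappa>"
    by (simp add: algebra_simps)
  moreover have "M < a'" "0 < s + (real a - J)"
    using \<open>b < a'\<close> \<open>M < b\<close> \<open>0 < s\<close> \<open>J < a\<close> by auto
  ultimately have "switch p J (-\<sigma>) t' a' a V' \<and> M < a' \<and> M < a \<and> 0 < s + (real a - J) \<and>
    (real p + 1) * (real a' - J) + p * (real a - J) + 2 * (s + (real a - J)) \<le> V' \<and>
    real a' - J \<le> (\<rho> - real (Suc n) * \<kappa>) * (s + (real a - J)) \<and> real a' \<le> D * (1 + c) ^ Suc n"
    using sw' \<open>M < a\<close> V' by (intro conjI) simp_all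
  then show ?case by (intro exI)
qed

text \<open>The first snapshot comes with partial sum 0, which admits no ratio; one phase later
  \<open>real a - J\<close> is a positive one. The frontiers \<open>b\<close>, \<open>a\<close> and
  \<open>a'\<close> cost a factor 1 + c each, hence the exponent 3.\<close>

lemma switch_base:
  fixes c e :: real and J M :: nat
  assumes "odd p" "0 \<le> c"
    and expl: "\<And>\<sigma> j. \<sigma> \<in> {1, -1} \<Longrightarrow> J \<le> j \<Longrightarrow> real j \<le> M * (1 + c) ^ 3 \<Longrightarrow>
      \<exists>u. real u \<le> c * real j \<and> p \<le> crossings \<sigma> j u"
    and M: "\<And>a. M < a \<Longrightarrow> c * real a \<le> (e + 2 * real p + 3) * (real a - J)"
    and "J \<le> M"
  obtains \<sigma> t a b V s where "switch p J \<sigma> t a b V" "M < a" "M < b" "0 < s"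
      "(real p + 1) * (real a - J) + p * (real b - J) + 2 * s \<le> V"
      "real a - J \<le> (e + real p + 1) / (real p + 1) * s" "real a \<le> M * (1 + c) ^ 3"
proof -
  have "0 < p" using \<open>odd p\<close> by (rule odd_pos)
  have powers: "M * (1 + c) ^ i \<le> M * (1 + c) ^ 3" if "i \<le> 3" for i
    using that \<open>0 \<le> c\<close> by (intro mult_left_mono power_increasing) auto
  \<comment> \<open>By time c M every edge from \<open>J\<close> to \<open>M\<close> on either side
    has \<open>p\<close> crossings.\<close>
  define T where "T = nat \<lfloor>c * M\<rfloor>"
  have "real T \<le> c * M" using \<open>0 \<le> c\<close> by (simp add: T_def)
  have frT: "real b \<le> M * (1 + c) ^ 1" if "frontier p J 1 T b" for b
  proof -
    have "p * (b - J) \<le> T" using frontier_le[OF that] by simp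
    moreover have "1 * (b - J) \<le> p * (b - J)" using \<open>0 < p\<close> by (intro mult_right_mono) auto
    ultimately have "real b \<le> real T + J" by linarith
    also have "\<dots> \<le> c * M + M" using \<open>real T \<le> c * M\<close> \<open>J \<le> M\<close> by simp
    finally show ?thesis by (simp add: algebra_simps)
  qed
  have T: "p \<le> crossings \<sigma> j T" if \<sigma>: "\<sigma> \<in> {1, -1}" and j: "j \<in> {J..M}" for \<sigma> j
  proof -
    have "real j \<le> M * (1 + c) ^ 0" using j by simp
    also note powers[of 0]
    finally obtain u where u: "real u \<le> c * real j" "p \<le> crossings \<sigma> j u"
      using expl[OF \<sigma>, of j] j by auto
    have "real u \<le> c * M"
      using u(1) j \<open>0 \<le> c\<close> by (elim order_trans) (intro mult_left_mono, auto)
    then have "u \<le> T" by (simp add: T_def le_nat_floor)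
    with u crossings_mono[of u T \<sigma> j] show ?thesis by linarith
  qed
  have "\<exists>u. real u \<le> c * real b \<and> p \<le> crossings 1 b u" if "frontier p J 1 T b" for b
    using that frT[OF that] powers[of 1] by (intro expl) (auto simp: frontier_def)
  then obtain t a b V where sw: "switch p J 1 t a b V" and tb: "real t \<le> c * real b"
    and "M < a" "M < b" and fr: "frontier p J 1 T b"
    and "(p + 1) * (a - J) + p * (b - J) \<le> V"
    using switch_exists[OF \<open>odd p\<close> T \<open>J \<le> M\<close>] by metis
  then have V: "(real p + 1) * (real a - J) + p * (real b - J) + 2 * 0 \<le> V"
    using \<open>J \<le> M\<close> of_nat_mono[of "(p + 1) * (a - J) + p * (b - J)" V, where 'a = real]
    by (simp add: of_nat_diff distrib_right)
  have "J < a" "J < b" using \<open>M < a\<close> \<open>M < b\<close> \<open>J \<le> M\<close> by auto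
  have grow: "real x \<le> M * (1 + c) ^ Suc i"
    if "(real p + 1) * (real x - J) + r \<le> c * real y" "0 \<le> r" "J < x" "J < y"
      "real y \<le> M * (1 + c) ^ i" for x y r i
  proof -
    have "1 * (real x - J) \<le> (real p + 1) * (real x - J)"
      using that by (intro mult_right_mono) auto
    then have "real x \<le> (1 + c) * real y"
      using that by (simp add: algebra_simps)
    also have "\<dots> \<le> (1 + c) * (M * (1 + c) ^ i)"
      using that \<open>0 \<le> c\<close> by (intro mult_left_mono) auto
    finally show ?thesis by (simp add: mult_ac)
  qed
  have a: "real a \<le> M * (1 + c) ^ Suc 1"
  proof (rule grow)
    show "(real p + 1) * (real a - J) + p * (real b - J) \<le> c * real b"
      using V switch_le[OF sw] tb by linarith
  qed (use \<open>J < a\<close> \<open>J < b\<close> frT[OF fr] in auto)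
  then have "\<exists>u. real u \<le> c * real a \<and> p \<le> crossings (-1) a u"
    using \<open>J < a\<close> powers[of "Suc 1"] by (intro expl) auto
  then obtain t' a' V' where sw': "switch p J (-1) t' a' a V'" and "b < a'"
    and V'c: "real V' \<le> c * real a"
    and V': "(real p + 1) * (real a' - J) + p * (real a - J) + 2 * (0 + (real a - J)) \<le> V'"
    using switch_next_real[OF \<open>odd p\<close> sw \<open>0 \<le> c\<close> _ V] by blast
  have "J < a'" using \<open>b < a'\<close> \<open>J < b\<close> by simp
  have "real a' \<le> M * (1 + c) ^ Suc (Suc 1)"
  proof (rule grow)
    show "(real p + 1) * (real a' - J) + (real p + 2) * (real a - J) \<le> c * real a"
      using V' V'c by (simp add: algebra_simps)
  qed (use \<open>J < a\<close> \<open>J < a'\<close> a in auto)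
  moreover have "(real p + 1) * (real a' - J) \<le> (e + real p + 1) * (real a - J)"
    using V' V'c M[OF \<open>M < a\<close>] by (simp add: algebra_simps)
  then have "real a' - J \<le> (e + real p + 1) / (real p + 1) * (real a - J)"
    by (simp add: field_simps)
  ultimately show ?thesis
    using that[OF sw', of "real a - J"] V' \<open>b < a'\<close> \<open>M < b\<close> \<open>M < a\<close> \<open>J < a\<close>
    by (simp add: numeral_3_eq_3)
qed

end

text \<open>
  The horizon factor \<open>G\<close> does not depend on the walk, since validity only provides walks that
  approximate on bounded time intervals.
\<close>

lemma unit_walk_lower_bound:
  fixes c :: real
  assumes "odd p" "2 * real p + 3 \<le> c" "c < 2 * real p + 3 + sqrt (8 * (real p + 1))"
  shows "\<exists>G>0::real. \<forall>w J. unit_walk w \<longrightarrow> 0 < J \<longrightarrow>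
      (\<exists>\<sigma>\<in>{1, -1}. \<exists>j\<ge>J. real j \<le> G * J \<and>
        (\<forall>u. real u \<le> c * real j \<longrightarrow> unit_walk.crossings w \<sigma> j u < p))"
proof -
  define P where "P = real p + 1"
  \<comment> \<open>The room between \<open>c\<close> and \<open>c'\<close> pays for replacing a by
    a - J.\<close>
  obtain c' where c': "c < c'" "c' < 2 * real p + 3 + sqrt (8 * P)"
    using dense assms(3) unfolding P_def by blast
  define e where "e = c' - (2 * real p + 3)"
  have "0 < P" "0 \<le> e" "e < sqrt (8 * P)" using c' assms(2) by (auto simp: e_def P_def)
  then have "e\<^sup>2 < (sqrt (8 * P))\<^sup>2" by (intro power_strict_mono) auto
  then have "e\<^sup>2 < 8 * P" using \<open>0 < P\<close> by simp
  then obtain \<kappa> where "0 < \<kappa>" and disc: "(e + P * \<kappa>)\<^sup>2 \<le> 4 * P * (2 - P * \<kappa>)"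
    using negative_discriminant_margin \<open>0 < P\<close> \<open>0 \<le> e\<close> by blast
  \<comment> \<open>The ratio is at most (e + P) / P in the snapshot of \<open>switch_base\<close>,
    so \<open>N\<close> decrements by \<kappa> make its bound negative.\<close>
  obtain N :: nat where N: "(e + P) / P < real N * \<kappa>"
    using reals_Archimedean3[OF \<open>0 < \<kappa>\<close>] by blast
  \<comment> \<open>This choice makes c a \<le> c' (a - J) for all a > m J.\<close>
  obtain m :: nat where m: "c' < real m * (c' - c)"
    using reals_Archimedean3[of "c' - c"] c' by auto
  have "0 < c" "0 < c'" using assms(2) c' by linarith+
  have "1 \<le> m" using m \<open>0 < c'\<close> by (cases m) auto
  \<comment> \<open>In units of \<open>J\<close>: m for the threshold \<open>M\<close>, (1 + c)^3
    for the initial snapshot, (1 + c)^N for the phases.\<close>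
  define G where "G = real m * (1 + c) ^ 3 * (1 + c) ^ N"
  have "0 < G" using \<open>1 \<le> m\<close> \<open>0 < c\<close> by (simp add: G_def)
  moreover have "\<exists>\<sigma>\<in>{1, -1}. \<exists>j\<ge>J. real j \<le> G * J \<and>
        (\<forall>u. real u \<le> c * real j \<longrightarrow> unit_walk.crossings w \<sigma> j u < p)"
    if "unit_walk w" "0 < J" for w J
  proof (rule ccontr)
    interpret unit_walk w by fact
    assume "\<not> ?thesis"
    then have expl: "\<exists>u. real u \<le> c * real j \<and> p \<le> crossings \<sigma> j u"
      if "\<sigma> \<in> {1, -1}" "J \<le> j" "real j \<le> G * J" for \<sigma> j
      using that by (metis not_le)
    define M where "M = m * J"
    define D where "D = real M * (1 + c) ^ 3"
    have GD: "G * J = D * (1 + c) ^ N" by (simp add: G_def D_def M_def)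
    have "J \<le> M" using \<open>1 \<le> m\<close> by (simp add: M_def)
    have M: "c * real a \<le> (e + 2 * real p + 3) * (real a - J)" if "M < a" for a
    proof -
      have "c' * J \<le> real m * (c' - c) * J" using m by (intro mult_right_mono) auto
      also have "\<dots> = (c' - c) * real M" by (simp add: M_def)
      also have "\<dots> \<le> (c' - c) * real a" using that c' by (intro mult_left_mono) auto
      finally show ?thesis by (simp add: e_def algebra_simps)
    qed
    have "D * 1 \<le> D * (1 + c) ^ N"
      using \<open>0 < c\<close> by (intro mult_left_mono one_le_power) (auto simp: D_def)
    then have DG: "D \<le> G * J" by (simp add: GD)
    have expl0: "\<exists>u. real u \<le> c * real j \<and> p \<le> crossings \<sigma> j u"
      if "\<sigma> \<in> {1, -1}" "J \<le> j" "real j \<le> M * (1 + c) ^ 3" for \<sigma> j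
      using that DG by (intro expl) (auto simp: D_def)
    have "0 \<le> c" using \<open>0 < c\<close> by simp
    obtain \<sigma> t a b V s where base: "switch p J \<sigma> t a b V" "M < a" "M < b" "0 < s"
      "(real p + 1) * (real a - J) + p * (real b - J) + 2 * s \<le> V"
      "real a - J \<le> (e + real p + 1) / (real p + 1) * s" "real a \<le> D"
      unfolding D_def
      by (rule switch_base[OF \<open>odd p\<close> \<open>0 \<le> c\<close> _ _ \<open>J \<le> M\<close>]) (use expl0 M in blast)+
    have "\<exists>\<sigma> t a b V s. switch p J \<sigma> t a b V \<and> M < a \<and> M < b \<and> 0 < s \<and>
      (real p + 1) * (real a - J) + p * (real b - J) + 2 * s \<le> V \<and>
      real a - J \<le> ((e + real p + 1) / (real p + 1) - real N * \<kappa>) * s \<and> real a \<le> D * (1 + c) ^ N"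
      using disc expl M \<open>0 < c\<close> unfolding P_def GD
      by (intro switch_chain[OF \<open>odd p\<close> _ _ _ _ \<open>J \<le> M\<close> base, of c N e]) auto
    then obtain a s where "M < a" "0 < s"
      and "real a - J \<le> ((e + real p + 1) / (real p + 1) - real N * \<kappa>) * s"
      by blast
    moreover have "((e + real p + 1) / (real p + 1) - real N * \<kappa>) * s < 0"
      using N \<open>0 < s\<close> by (intro mult_neg_pos) (auto simp: P_def add.assoc)
    ultimately show False using \<open>J \<le> M\<close> by linarith
  qed
  ultimately show ?thesis by blast
qed

section \<open>From search algorithms to unit walks\<close>

definition lattice_position :: "(nat \<Rightarrow> real) \<Rightarrow> nat \<Rightarrow> int" where
  "lattice_position d k = (\<Sum>i<k. if d i = 1 then 1 else -1)"

lemma unit_walk_lattice_position: "unit_walk (lattice_position d)"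
  by unfold_locales (auto simp: lattice_position_def)

text \<open>
  At the midpoint of an edge the walk uses a single mode, so that passing it in \<open>p\<close> modes takes
  \<open>p\<close> crossings.
\<close>

lemma walk_crossings:
  assumes "0 < \<epsilon>" and d: "\<And>k. d k \<in> {-1, 1}" and \<sigma>: "\<sigma> \<in> {1, -1}"
    and passes: "\<And>i. i < p \<Longrightarrow>
      \<exists>s. 0 \<le> s \<and> s \<le> S \<and> passes (walk \<epsilon> d m) i (real_of_int \<sigma> * (real j + 1 / 2) * \<epsilon>) s"
  shows "p \<le> unit_walk.crossings (lattice_position d) \<sigma> j (Suc (nat \<lfloor>S / \<epsilon>\<rfloor>))"
proof -
  define w where "w = lattice_position d"
  interpret unit_walk w unfolding w_def by (rule unit_walk_lattice_position)
  define K where "K = {k. k < Suc (nat \<lfloor>S / \<epsilon>\<rfloor>) \<and> min (\<sigma> * w k) (\<sigma> * w (Suc k)) = int j}"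
  have w: "real_of_int (w k) = (\<Sum>i<k. d i)" for k
    unfolding w_def lattice_position_def of_int_sum
  proof (intro sum.cong refl)
    show "real_of_int (if d i = 1 then 1 else -1) = d i" for i
      using d[of i] by auto
  qed
  have wSuc: "real_of_int (w (Suc k)) = w k + d k" for k
    by (simp add: w)
  \<comment> \<open>Each step has one mode, so if the steps crossing the edge use all
    \<open>p\<close> modes, there are at least \<open>p\<close> of them.\<close>
  have "i \<in> m ` K" if i: "i < p" for i
  proof -
    obtain s where s: "0 \<le> s" "s \<le> S"
      and pass: "passes (walk \<epsilon> d m) i (real_of_int \<sigma> * (real j + 1 / 2) * \<epsilon>) s"
      using passes[OF i] by blast
    \<comment> \<open>Step \<open>k\<close> is under way at time \<open>s\<close>, and
      \<open>v\<close> is the fraction of it already covered.\<close>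
    define k where "k = nat \<lfloor>s / \<epsilon>\<rfloor>"
    define v where "v = s / \<epsilon> - k"
    have kfloor: "real k = of_int \<lfloor>s / \<epsilon>\<rfloor>"
      using s \<open>0 < \<epsilon>\<close> by (simp add: k_def)
    then have v: "0 \<le> v" "v < 1"
      unfolding v_def by linarith+
    have sv: "s - real k * \<epsilon> = \<epsilon> * v"
      using \<open>0 < \<epsilon>\<close> by (simp add: v_def field_simps)
    from pass have "\<epsilon> * w k + d k * (s - real k * \<epsilon>) = real_of_int \<sigma> * (real j + 1 / 2) * \<epsilon>"
      by (simp add: passes_def walk_def Let_def k_def w)
    then have "\<epsilon> * (w k + d k * v) = \<epsilon> * (real_of_int \<sigma> * (real j + 1 / 2))"
      unfolding sv by (simp add: algebra_simps)
    then have "w k + d k * v = real_of_int \<sigma> * (real j + 1 / 2)"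
      using \<open>0 < \<epsilon>\<close> by simp
    then have pos: "real_of_int (\<sigma> * w k) + \<sigma> * d k * v = real j + 1 / 2"
      using \<sigma> by auto
    have "\<sigma> * d k = 1 \<or> \<sigma> * d k = -1" using \<sigma> d[of k] by auto
    \<comment> \<open>\<open>w k\<close> is an integer and \<open>v\<close> lies in [0, 1), so the
      midpoint of an edge is reached only halfway through a step.\<close>
    then have edge: "min (\<sigma> * w k) (\<sigma> * w (Suc k)) = int j \<and> v = 1 / 2"
    proof
      assume \<sigma>d: "\<sigma> * d k = 1"
      then have "real_of_int (\<sigma> * w k) + v = real j + 1 / 2" using pos by simp
      moreover from this have "\<sigma> * w k = int j" using v by linarith
      ultimately have "\<sigma> * w k = int j" "v = 1 / 2" by simp_all
      moreover have "real_of_int (\<sigma> * w (Suc k)) = real_of_int (\<sigma> * w k + 1)"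
        using \<sigma>d by (simp add: wSuc distrib_left)
      ultimately show ?thesis unfolding of_int_eq_iff by simp
    next
      assume \<sigma>d: "\<sigma> * d k = -1"
      then have "real_of_int (\<sigma> * w k) - v = real j + 1 / 2" using pos by simp
      moreover from this have "\<sigma> * w k = int j + 1" using v by linarith
      ultimately have "\<sigma> * w k = int j + 1" "v = 1 / 2" by simp_all
      moreover have "real_of_int (\<sigma> * w (Suc k)) = real_of_int (\<sigma> * w k - 1)"
        using \<sigma>d by (simp add: wSuc distrib_left)
      ultimately show ?thesis unfolding of_int_eq_iff by simp
    qed
    then have s_eq: "s = (real k + 1 / 2) * \<epsilon>"
      using sv by (simp add: algebra_simps)
    \<comment> \<open>The closed time intervals of different steps share at most end points, so
      halfway through step \<open>k\<close> only its mode is in use.\<close>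
    from pass obtain k' where k': "i = m k'" "real k' * \<epsilon> \<le> s" "s \<le> real (Suc k') * \<epsilon>"
      by (auto simp: passes_def walk_def)
    then have "real k' \<le> real k + 1 / 2" "real k + 1 / 2 \<le> real (Suc k')"
      unfolding s_eq using \<open>0 < \<epsilon>\<close> by (simp_all only: mult_le_cancel_right_pos)
    then have "k' = k" by linarith
    have "s / \<epsilon> \<le> S / \<epsilon>" using s \<open>0 < \<epsilon>\<close> by (simp add: divide_right_mono)
    then have "k \<le> nat \<lfloor>S / \<epsilon>\<rfloor>" unfolding k_def by (intro nat_mono floor_mono)
    with edge k' \<open>k' = k\<close> show ?thesis by (auto simp: K_def)
  qed
  then have "{..<p} \<subseteq> m ` K" by auto
  moreover have "finite K" by (simp add: K_def)
  ultimately have "card {..<p} \<le> card K"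
    by (meson card_image_le card_mono finite_imageI order_trans)
  then show ?thesis
    unfolding w_def[symmetric] by (simp add: crossings_def K_def)
qed

lemma explored_before_CR:
  assumes "search_algorithm p A" "CR p A < ereal c" "1 \<le> \<bar>x\<bar>"
  obtains t where "0 \<le> t" "t < c * \<bar>x\<bar>" "explored p A x t"
proof -
  have "ereal (CR_at p A x) \<le> CR p A"
    unfolding CR_def using assms(3) by (intro SUP_upper) auto
  with assms(2) have "CR_at p A x < c"
    by (metis le_less_trans less_ereal.simps(1))
  then have "exploration_time p A x < c * \<bar>x\<bar>"
    using assms(3) unfolding CR_at_def by (subst (asm) pos_divide_less_eq) auto
  \<comment> \<open>Nonemptiness rules out the unspecified \<open>Inf\<close> of the empty set, so
    some actual exploration time is below the bound.\<close>
  moreover have "{t. 0 \<le> t \<and> explored p A x t} \<noteq> {}"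
    using assms(1) by (auto simp: search_algorithm_def)
  ultimately obtain t where "t \<in> {t. 0 \<le> t \<and> explored p A x t}" "t < c * \<bar>x\<bar>"
    unfolding exploration_time_def by (meson cInf_lessD)
  then show ?thesis using that by auto
qed

theorem theorem3:
  fixes p :: nat
  assumes "p \<ge> 1" and "odd p"
  shows "\<not> (\<exists>A. search_algorithm p A \<and> CR p A < ereal (2 * real p + 3 + sqrt (8 * (real p + 1))))"
proof
  define C where "C = 2 * real p + 3 + sqrt (8 * (real p + 1))"
  assume "\<exists>A. search_algorithm p A \<and> CR p A < ereal (2 * real p + 3 + sqrt (8 * (real p + 1)))"
  then obtain A where A: "search_algorithm p A" and "CR p A < ereal C"
    by (auto simp: C_def)
  then obtain r where "CR p A < ereal r" "r < C"
    using ereal_dense2[of "CR p A" "ereal C"] by auto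
  \<comment> \<open>The maximum secures the lower bound on the constant that
    \<open>unit_walk_lower_bound\<close> assumes.\<close>
  define c0 where "c0 = max r (2 * real p + 3)"
  have CR: "CR p A < ereal c0"
    using \<open>CR p A < ereal r\<close> by (rule less_le_trans) (simp add: c0_def)
  have c0: "2 * real p + 3 \<le> c0" "c0 < C"
    using \<open>r < C\<close> by (auto simp: c0_def C_def)
  then obtain c where c: "c0 < c" "c < C" using dense by blast
  \<comment> \<open>Half of the slack c - c0 pays for the time error of the approximation, the other
    half for rounding to midpoints and whole steps.\<close>
  define \<delta> where "\<delta> = (c - c0) / 2"
  have "0 < \<delta>" "0 < c0" using c c0 by (auto simp: \<delta>_def)
  obtain G :: real where "0 < G" and G: "\<And>w J. unit_walk w \<Longrightarrow> 0 < J \<Longrightarrow>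
      \<exists>\<sigma>\<in>{1, -1}. \<exists>j\<ge>J. real j \<le> G * J \<and>
        (\<forall>u. real u \<le> c * real j \<longrightarrow> unit_walk.crossings w \<sigma> j u < p)"
    using unit_walk_lower_bound[OF \<open>odd p\<close>, of c] c c0 unfolding C_def by auto
  \<comment> \<open>The midpoint \<open>x\<close> chosen below is at most 2 G + 1, so
    \<open>A\<close> explores it before time \<open>H\<close>.\<close>
  define H where "H = c0 * (2 * G + 1)"
  have "0 < H" using \<open>0 < c0\<close> \<open>0 < G\<close> by (simp add: H_def)
  \<comment> \<open>Below this step size the rounding cost c0 / 2 + 1 is at most \<delta> /
    \<epsilon>.\<close>
  define \<epsilon>0 where "\<epsilon>0 = min 1 (\<delta> / (c0 / 2 + 1))"
  have "0 < \<epsilon>0" using \<open>0 < \<delta>\<close> \<open>0 < c0\<close> by (simp add: \<epsilon>0_def)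
  have "\<forall>\<^sub>F \<epsilon> in at_right 0. \<exists>d m. (\<forall>k. d k \<in> {-1, 1}) \<and> (\<forall>k. m k < p) \<and>
      approximates \<delta> H (walk \<epsilon> d m) A"
    using A \<open>0 < \<delta>\<close> \<open>0 < H\<close> unfolding search_algorithm_def valid_pattern_def by blast
  from eventually_happens'[OF trivial_limit_at_right_real
      eventually_conj[OF this eventually_at_right_real[OF \<open>0 < \<epsilon>0\<close>]]]
  obtain \<epsilon> d m where d: "\<And>k. d k \<in> {-1, 1 :: real}"
    and approx: "approximates \<delta> H (walk \<epsilon> d m) A" and \<epsilon>: "0 < \<epsilon>" "\<epsilon> < \<epsilon>0"
    unfolding greaterThanLessThan_iff by blast
  \<comment> \<open>As J \<epsilon> \<ge> 1, midpoints of edges from \<open>J\<close> on have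
    distance at least 1 and must be searched.\<close>
  define J where "J = nat \<lceil>1 / \<epsilon>\<rceil>"
  have J: "1 / \<epsilon> \<le> J" "J \<le> 1 / \<epsilon> + 1"
    using \<epsilon> by (auto simp: J_def intro: real_nat_ceiling_ge)
  have "0 < J" using \<epsilon> by (simp add: J_def)
  then obtain \<sigma> j where \<sigma>: "\<sigma> \<in> {1, -1}" and "J \<le> j" "real j \<le> G * J"
    and slow: "\<And>u. real u \<le> c * real j \<Longrightarrow> unit_walk.crossings (lattice_position d) \<sigma> j u < p"
    using G[OF unit_walk_lattice_position] by metis
  define x where "x = (real j + 1 / 2) * \<epsilon>"
  have "1 / \<epsilon> \<le> j" using J \<open>J \<le> j\<close> by linarith
  then have "1 \<le> x"
    using \<epsilon> by (simp add: x_def field_simps)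
  have "x \<le> 2 * G + 1"
  proof -
    have "real j \<le> G * (1 / \<epsilon> + 1)"
      using \<open>real j \<le> G * J\<close> J \<open>0 < G\<close> by (meson mult_left_mono less_imp_le order_trans)
    then have "x \<le> (G * (1 / \<epsilon> + 1) + 1 / 2) * \<epsilon>"
      unfolding x_def using \<epsilon> by (intro mult_right_mono) auto
    also have "\<dots> = G + (G + 1 / 2) * \<epsilon>"
      using \<epsilon> by (simp add: field_simps)
    also have "\<dots> \<le> G + (G + 1 / 2) * 1"
      using \<epsilon> \<open>0 < G\<close> by (intro add_left_mono mult_left_mono) (auto simp: \<epsilon>0_def)
    finally show ?thesis by simp
  qed
  have abs_x: "\<bar>real_of_int \<sigma> * x\<bar> = x" using \<sigma> \<open>1 \<le> x\<close> by auto
  then obtain \<tau> where \<tau>: "0 \<le> \<tau>" "\<tau> < c0 * x" "explored p A (\<sigma> * x) \<tau>"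
    using explored_before_CR[OF A CR, of "\<sigma> * x"] \<open>1 \<le> x\<close> by auto
  have "c0 * x \<le> H"
    unfolding H_def using \<open>x \<le> 2 * G + 1\<close> \<open>0 < c0\<close> by (intro mult_left_mono) auto
  define S where "S = c0 * x + \<delta>"
  have "\<exists>s. 0 \<le> s \<and> s \<le> S \<and> passes (walk \<epsilon> d m) i (\<sigma> * (real j + 1 / 2) * \<epsilon>) s"
    if i: "i < p" for i
  proof -
    obtain s where s: "0 \<le> s" "s \<le> \<tau>" "passes A i (\<sigma> * x) s"
      using \<tau>(3) \<open>1 \<le> x\<close> i unfolding explored_def abs_x by auto
    then have "s \<in> {0..H}" "i \<in> modes A s" "pos A s = \<sigma> * x"
      using \<tau> \<open>c0 * x \<le> H\<close> by (auto simp: passes_def)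
    then obtain s' where "0 \<le> s'" "\<bar>s' - s\<bar> \<le> \<delta>" "passes (walk \<epsilon> d m) i (\<sigma> * x) s'"
      using approx unfolding approximates_def by metis
    then show ?thesis
      using s \<tau> by (intro exI[of _ s']) (auto simp: S_def x_def mult.assoc)
  qed
  then have "p \<le> unit_walk.crossings (lattice_position d) \<sigma> j (Suc (nat \<lfloor>S / \<epsilon>\<rfloor>))"
    using d by (intro walk_crossings[OF \<epsilon>(1) _ \<sigma>])
  moreover have "real (Suc (nat \<lfloor>S / \<epsilon>\<rfloor>)) \<le> c * real j"
  proof -
    have "0 \<le> S" using \<open>0 < c0\<close> \<open>1 \<le> x\<close> \<open>0 < \<delta>\<close> by (simp add: S_def)
    then have "real (Suc (nat \<lfloor>S / \<epsilon>\<rfloor>)) \<le> S / \<epsilon> + 1"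
      using \<epsilon> by simp
    moreover have "S / \<epsilon> = c0 * (real j + 1 / 2) + \<delta> / \<epsilon>"
      using \<epsilon> by (simp add: S_def x_def add_divide_distrib)
    ultimately have 1: "real (Suc (nat \<lfloor>S / \<epsilon>\<rfloor>)) \<le> c0 * real j + \<delta> / \<epsilon> + (c0 / 2 + 1)"
      by (simp only: distrib_left)
    \<comment> \<open>Since j \<epsilon> \<ge> 1, an error of \<delta> / \<epsilon> steps is
      proportional to \<open>j\<close> and fits into the larger constant \<open>c\<close>.\<close>
    have 2: "\<delta> / \<epsilon> \<le> \<delta> * real j"
      using mult_left_mono[OF \<open>1 / \<epsilon> \<le> j\<close>, of \<delta>] \<open>0 < \<delta>\<close> by simp
    have "\<epsilon> \<le> \<delta> / (c0 / 2 + 1)" using \<epsilon> by (simp add: \<epsilon>0_def)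
    then have "c0 / 2 + 1 \<le> \<delta> / \<epsilon>"
      using \<epsilon> \<open>0 < c0\<close> by (simp add: pos_le_divide_eq mult.commute)
    with 1 2 have "real (Suc (nat \<lfloor>S / \<epsilon>\<rfloor>)) \<le> c0 * real j + 2 * (\<delta> * real j)"
      by linarith
    also have "\<dots> = (c0 + 2 * \<delta>) * real j" by (simp add: algebra_simps)
    also have "c0 + 2 * \<delta> = c" by (simp add: \<delta>_def field_simps)
    finally show ?thesis .
  qed
  ultimately show False using slow by (meson leD)
qed

end
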